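(* Let $d_1,d_2\in\mathbb{N}$. Every $C^*$-extreme point of $\mathrm{UEB}(d_1,d_2)$ is a linear extreme point of $\mathrm{UEB}(d_1,d_2)$; that is, $\mathrm{UEB}_{C^*\text{-}ext}(d_1,d_2)\subseteq\mathrm{UEB}_{ext}(d_1,d_2)$.
   Context: $M_d$ is the algebra of complex $d\times d$ matrices; $\mathrm{Ad}_V(X)=V^*XV$. A positive semidefinite matrix $X\in M_k\otimes M_{d}$ is separable if $X=\sum_{i=1}^nA_i\otimes B_i$ with $A_i\in M_k$, $B_i\in M_d$ positive semidefinite. A completely positive map $\Phi:M_{d_1}\to M_{d_2}$ is entanglement breaking (an EB-map) if for every $k\ge1$ and every positive semidefinite $X\in M_k\otimes M_{d_1}$ the matrix $(\mathrm{id}_k\otimes\Phi)(X)$ is separable. $\mathrm{UEB}(d_1,d_2)$ is the (convex) set of all unital EB-maps $M_{d_1}\to M_{d_2}$. $\Phi\in\mathrm{UEB}(d_1,d_2)$ is a linear extreme point (member of $\mathrm{UEB}_{ext}(d_1,d_2)$) if, whenever $\Phi=\sum_{i=1}^nt_i\Phi_i$ with $\Phi_i\in\mathrm{UEB}(d_1,d_2)$, $t_i\in(0,1)$ and $\sum_{i=1}^nt_i=1$, then $\Phi_i=\Phi$ for all $i$. It is a $C^*$-extreme point (member of $\mathrm{UEB}_{C^*\text{-}ext}(d_1,d_2)$) if, whenever $\Phi=\sum_{i=1}^n\mathrm{Ad}_{T_i}\circ\Phi_i$ with $T_i\in M_{d_2}$ invertible, $\sum_{i=1}^nT_i^*T_i=I_{d_2}$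 and $\Phi_i\in\mathrm{UEB}(d_1,d_2)$, then there exist unitaries $U_i\in M_{d_2}$ such that $\Phi_i=\mathrm{Ad}_{U_i}\circ\Phi$ for all $1\le i\le n$. *)

theory Defs
  imports "Jordan_Normal_Form.Schur_Decomposition"
begin

(* M_d is carrier_mat d d over complex. A map from M_d1 to M_d2 is represented by a function on
   all complex matrices of which only the values on carrier_mat d1 d1 matter; hence two maps are
   compared only on carrier_mat d1 d1. *)

definition finsum_mat :: "nat \<Rightarrow> ('i \<Rightarrow> complex mat) \<Rightarrow> 'i set \<Rightarrow> complex mat" where
  "finsum_mat d = finsum (module_mat TYPE(complex) d d)"

definition unitary_mat :: "nat \<Rightarrow> complex mat \<Rightarrow> bool" where
  "unitary_mat d U \<longleftrightarrow> U \<in> carrier_mat d d \<and>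
     mat_adjoint U * U = 1\<^sub>m d \<and> U * mat_adjoint U = 1\<^sub>m d"

(* The order on complex is that of Complex_Order: 0 <= z says that z is real and nonnegative. *)
definition psd_mat :: "nat \<Rightarrow> complex mat \<Rightarrow> bool" where
  "psd_mat d A \<longleftrightarrow> A \<in> carrier_mat d d \<and> (\<forall>v \<in> carrier_vec d. 0 \<le> (A *\<^sub>v v) \<bullet>c v)"

definition Ad :: "complex mat \<Rightarrow> complex mat \<Rightarrow> complex mat" where
  "Ad V X = mat_adjoint V * X * V"

(* M_k \<otimes> M_d is identified with M_(k*d) through the Kronecker product: the matrix entry at
   (i*d+a, j*d+b) is the entry (a,b) of the d x d block in position (i,j). *)
definition kron :: "complex mat \<Rightarrow> complex mat \<Rightarrow> complex mat" where
  "kron A B = mat (dim_row A * dim_row B) (dim_col A * dim_col B)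
     (\<lambda>(r, c). A $$ (r div dim_row B, c div dim_col B) * B $$ (r mod dim_row B, c mod dim_col B))"

definition block :: "nat \<Rightarrow> complex mat \<Rightarrow> nat \<Rightarrow> nat \<Rightarrow> complex mat" where
  "block d X i j = mat d d (\<lambda>(a, b). X $$ (i * d + a, j * d + b))"

(* id_k \<otimes> \<Phi> applies \<Phi> to each block; see ampl_kron below. *)
definition ampl :: "nat \<Rightarrow> nat \<Rightarrow> nat \<Rightarrow> (complex mat \<Rightarrow> complex mat) \<Rightarrow> complex mat \<Rightarrow> complex mat" where
  "ampl d1 d2 k \<Phi> X = mat (k * d2) (k * d2)
     (\<lambda>(r, c). \<Phi> (block d1 X (r div d2) (c div d2)) $$ (r mod d2, c mod d2))"

definition linear_mat_map :: "nat \<Rightarrow> nat \<Rightarrow> (complex mat \<Rightarrow> complex mat) \<Rightarrow> bool" where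
  "linear_mat_map d1 d2 \<Phi> \<longleftrightarrow>
     (\<forall>X \<in> carrier_mat d1 d1. \<Phi> X \<in> carrier_mat d2 d2) \<and>
     (\<forall>X \<in> carrier_mat d1 d1. \<forall>Y \<in> carrier_mat d1 d1. \<Phi> (X + Y) = \<Phi> X + \<Phi> Y) \<and>
     (\<forall>c. \<forall>X \<in> carrier_mat d1 d1. \<Phi> (c \<cdot>\<^sub>m X) = c \<cdot>\<^sub>m \<Phi> X)"

lemma ampl_kron:
  assumes \<Phi>: "linear_mat_map d1 d2 \<Phi>" and A: "A \<in> carrier_mat k k" and B: "B \<in> carrier_mat d1 d1"
  shows "ampl d1 d2 k \<Phi> (kron A B) = kron A (\<Phi> B)"
proof -
  have lt: "i * d1 + a < k * d1" if "i < k" "a < d1" for i a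
  proof -
    have "i * d1 + a < Suc i * d1" using that by simp
    also have "\<dots> \<le> k * d1" using that by (intro mult_le_mono1) simp
    finally show ?thesis .
  qed
  have blk: "block d1 (kron A B) i j = A $$ (i, j) \<cdot>\<^sub>m B" if "i < k" "j < k" for i j
    using A B that lt by (intro eq_matI) (auto simp: block_def kron_def)
  have \<Phi>B: "\<Phi> B \<in> carrier_mat d2 d2" using \<Phi> B by (auto simp: linear_mat_map_def)
  show ?thesis
  proof (rule eq_matI)
    fix r c assume "r < dim_row (kron A (\<Phi> B))" "c < dim_col (kron A (\<Phi> B))"
    hence rc: "r < k * d2" "c < k * d2" using A \<Phi>B by (auto simp: kron_def)
    have d2: "0 < d2" using rc by (cases d2) auto
    have q: "r div d2 < k" "c div d2 < k" "r mod d2 < d2" "c mod d2 < d2"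
      using rc d2 by (auto simp: less_mult_imp_div_less)
    have "\<Phi> (A $$ (r div d2, c div d2) \<cdot>\<^sub>m B) = A $$ (r div d2, c div d2) \<cdot>\<^sub>m \<Phi> B"
      using \<Phi> B by (auto simp: linear_mat_map_def)
    hence "ampl d1 d2 k \<Phi> (kron A B) $$ (r, c) = A $$ (r div d2, c div d2) * \<Phi> B $$ (r mod d2, c mod d2)"
      using rc q \<Phi>B by (simp add: ampl_def blk)
    thus "ampl d1 d2 k \<Phi> (kron A B) $$ (r, c) = kron A (\<Phi> B) $$ (r, c)"
      using rc A \<Phi>B by (simp add: kron_def)
  qed (use A \<Phi>B in \<open>auto simp: ampl_def kron_def\<close>)
qed

definition separable_mat :: "nat \<Rightarrow> nat \<Rightarrow> complex mat \<Rightarrow> bool" where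
  "separable_mat k d X \<longleftrightarrow> psd_mat (k * d) X \<and>
     (\<exists>n A B. (\<forall>i<n. psd_mat k (A i) \<and> psd_mat d (B i)) \<and>
        X = finsum_mat (k * d) (\<lambda>i. kron (A i) (B i)) {..<(n::nat)})"

definition completely_positive :: "nat \<Rightarrow> nat \<Rightarrow> (complex mat \<Rightarrow> complex mat) \<Rightarrow> bool" where
  "completely_positive d1 d2 \<Phi> \<longleftrightarrow> linear_mat_map d1 d2 \<Phi> \<and>
     (\<forall>k\<ge>1. \<forall>X. psd_mat (k * d1) X \<longrightarrow> psd_mat (k * d2) (ampl d1 d2 k \<Phi> X))"

definition entanglement_breaking :: "nat \<Rightarrow> nat \<Rightarrow> (complex mat \<Rightarrow> complex mat) \<Rightarrow> bool" where
  "entanglement_breaking d1 d2 \<Phi> \<longleftrightarrow> completely_positive d1 d2 \<Phi> \<and>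
     (\<forall>k\<ge>1. \<forall>X. psd_mat (k * d1) X \<longrightarrow> separable_mat k d2 (ampl d1 d2 k \<Phi> X))"

definition UEB :: "nat \<Rightarrow> nat \<Rightarrow> (complex mat \<Rightarrow> complex mat) set" where
  "UEB d1 d2 = {\<Phi>. entanglement_breaking d1 d2 \<Phi> \<and> \<Phi> (1\<^sub>m d1) = 1\<^sub>m d2}"

definition UEB_ext :: "nat \<Rightarrow> nat \<Rightarrow> (complex mat \<Rightarrow> complex mat) set" where
  "UEB_ext d1 d2 = {\<Phi> \<in> UEB d1 d2.
     \<forall>(n::nat) (t :: nat \<Rightarrow> real) \<Psi>.
       (\<forall>i<n. \<Psi> i \<in> UEB d1 d2 \<and> 0 < t i \<and> t i < 1) \<and>
       (\<Sum>i<n. t i) = 1 \<and>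
       (\<forall>X \<in> carrier_mat d1 d1.
          \<Phi> X = finsum_mat d2 (\<lambda>i. complex_of_real (t i) \<cdot>\<^sub>m \<Psi> i X) {..<n})
       \<longrightarrow> (\<forall>i<n. \<forall>X \<in> carrier_mat d1 d1. \<Psi> i X = \<Phi> X)}"

definition UEB_Cstar_ext :: "nat \<Rightarrow> nat \<Rightarrow> (complex mat \<Rightarrow> complex mat) set" where
  "UEB_Cstar_ext d1 d2 = {\<Phi> \<in> UEB d1 d2.
     \<forall>(n::nat) (T :: nat \<Rightarrow> complex mat) \<Psi>.
       (\<forall>i<n. \<Psi> i \<in> UEB d1 d2 \<and> T i \<in> carrier_mat d2 d2 \<and> invertible_mat (T i)) \<and>
       finsum_mat d2 (\<lambda>i. mat_adjoint (T i) * T i) {..<n} = 1\<^sub>m d2 \<and>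
       (\<forall>X \<in> carrier_mat d1 d1. \<Phi> X = finsum_mat d2 (\<lambda>i. Ad (T i) (\<Psi> i X)) {..<n})
       \<longrightarrow> (\<exists>U. \<forall>i<n. unitary_mat d2 (U i) \<and>
              (\<forall>X \<in> carrier_mat d1 d1. \<Psi> i X = Ad (U i) (\<Phi> X)))}"

end

theory Submission
  imports Defs "HOL-Analysis.Inner_Product"
begin

text \<open>
  A convex combination \<open>\<Phi> = \<Sum>i. t\<^sub>i \<Psi>\<^sub>i\<close> is the \<open>C\<^sup>*\<close>-convex combination whose coefficients
  are the invertible scalar matrices \<open>T\<^sub>i = \<surd>t\<^sub>i I\<close>, because \<open>Ad T\<^sub>i\<close> is multiplication by
  \<open>t\<^sub>i\<close> (lemma \<open>Ad_scalar\<close>). If \<open>\<Phi>\<close> is \<open>C\<^sup>*\<close>-extreme, then every \<open>\<Psi>\<^sub>i\<close> is therefore unitarily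
  equivalent to \<open>\<Phi>\<close>. What has to be shown is that it is equal to \<open>\<Phi>\<close>.

  Fix \<open>X\<close>. The matrix \<open>Y = \<Phi> X\<close> is then the average, with positive weights, of matrices
  \<open>Y\<^sub>i = \<Psi>\<^sub>i X\<close> in the unitary orbit of \<open>Y\<close>. Conjugation by a unitary preserves the
  Hilbert-Schmidt norm (lemma \<open>hs_norm_sq_unitary\<close>), so all these matrices lie on one sphere of a
  Euclidean space. Spheres in Euclidean space contain no segments, which forces \<open>Y\<^sub>i = Y\<close>.
  Quantitatively, the weighted variance \<open>\<Sum>i. t\<^sub>i \<parallel>Y\<^sub>i - Y\<parallel>\<^sup>2\<close> equals
  \<open>\<Sum>i. t\<^sub>i \<parallel>Y\<^sub>i\<parallel>\<^sup>2 - \<parallel>Y\<parallel>\<^sup>2 = 0\<close> (lemmas \<open>weighted_variance\<close> and \<open>hs_sphere_average\<close>).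
\<close>

section \<open>Sums, adjoints and scalar conjugations\<close>

lemma finsum_mat_index:
  assumes "finite I" and "\<And>i. i \<in> I \<Longrightarrow> f i \<in> carrier_mat d d"
  shows finsum_mat_carrier: "finsum_mat d f I \<in> carrier_mat d d"
    and "\<And>a b. a < d \<Longrightarrow> b < d \<Longrightarrow> finsum_mat d f I $$ (a, b) = (\<Sum>i\<in>I. f i $$ (a, b))"
proof -
  interpret abelian_group "module_mat TYPE(complex) d d" by (rule abelian_group_mat)
  have "finsum_mat d f I \<in> carrier_mat d d \<and>
      (\<forall>a<d. \<forall>b<d. finsum_mat d f I $$ (a, b) = (\<Sum>i\<in>I. f i $$ (a, b)))"
    using assms
  proof (induction I rule: finite_induct)
    case empty
    then show ?case by (simp add: finsum_mat_def finsum_empty module_mat_simps)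
  next
    case (insert j I)
    have "finsum_mat d f (insert j I) = f j + finsum_mat d f I"
      using insert finsum_insert[of I j f] by (auto simp: finsum_mat_def module_mat_simps)
    then show ?case using insert by auto
  qed
  then show "finsum_mat d f I \<in> carrier_mat d d"
    and "\<And>a b. a < d \<Longrightarrow> b < d \<Longrightarrow> finsum_mat d f I $$ (a, b) = (\<Sum>i\<in>I. f i $$ (a, b))"
    by auto
qed

lemma finsum_mat_cong:
  assumes "\<And>i. i \<in> I \<Longrightarrow> f i = g i" and "\<And>i. i \<in> I \<Longrightarrow> g i \<in> carrier_mat d d"
  shows "finsum_mat d f I = finsum_mat d g I"
proof -
  interpret abelian_group "module_mat TYPE(complex) d d" by (rule abelian_group_mat)
  show ?thesis unfolding finsum_mat_def
    by (rule finsum_cong') (use assms in \<open>auto simp: module_mat_simps\<close>)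
qed

lemma mat_adjoint_index [simp]:
  "i < dim_col A \<Longrightarrow> j < dim_row A \<Longrightarrow> mat_adjoint A $$ (i, j) = conjugate (A $$ (j, i))"
  by (simp add: mat_adjoint_def mat_of_rows_def)

lemma mat_adjoint_dim [simp]:
  "dim_row (mat_adjoint A) = dim_col A" "dim_col (mat_adjoint A) = dim_row A"
  by (simp_all add: mat_adjoint_def)

lemma mat_adjoint_carrier [simp]:
  "A \<in> carrier_mat n m \<Longrightarrow> mat_adjoint A \<in> carrier_mat m n"
  by (intro carrier_matI) auto

lemma mat_adjoint_mult:
  fixes A B :: "complex mat"
  assumes "A \<in> carrier_mat n m" "B \<in> carrier_mat m k"
  shows "mat_adjoint (A * B) = mat_adjoint B * mat_adjoint A"
  by (rule eq_matI) (use assms in \<open>auto simp: scalar_prod_def sum_conjugate mult.commute\<close>)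

lemma mat_adjoint_mat_adjoint [simp]: "mat_adjoint (mat_adjoint A) = (A :: complex mat)"
  by (rule eq_matI) auto

lemma mat_adjoint_real_scalar:
  "mat_adjoint (complex_of_real r \<cdot>\<^sub>m 1\<^sub>m d) = complex_of_real r \<cdot>\<^sub>m 1\<^sub>m d"
  by (rule eq_matI) auto

lemma Ad_scalar:
  assumes "Y \<in> carrier_mat d d"
  shows "Ad (complex_of_real r \<cdot>\<^sub>m 1\<^sub>m d) Y = complex_of_real (r\<^sup>2) \<cdot>\<^sub>m Y"
proof -
  have "complex_of_real r \<cdot>\<^sub>m 1\<^sub>m d * Y = complex_of_real r \<cdot>\<^sub>m Y"
    using assms by (subst mult_smult_assoc_mat[of _ d d _ d]) auto
  moreover have "(complex_of_real r \<cdot>\<^sub>m Y) * (complex_of_real r \<cdot>\<^sub>m 1\<^sub>m d)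
      = complex_of_real r \<cdot>\<^sub>m (complex_of_real r \<cdot>\<^sub>m Y)"
    using assms by (subst mult_smult_distrib[of _ d d _ d]) auto
  ultimately have "Ad (complex_of_real r \<cdot>\<^sub>m 1\<^sub>m d) Y = complex_of_real r \<cdot>\<^sub>m (complex_of_real r \<cdot>\<^sub>m Y)"
    by (simp add: Ad_def mat_adjoint_real_scalar)
  then show ?thesis by (auto simp: power2_eq_square)
qed

section \<open>The Hilbert-Schmidt norm\<close>

definition mat_trace :: "complex mat \<Rightarrow> complex" where
  "mat_trace A = (\<Sum>a<dim_row A. A $$ (a, a))"

lemma mat_trace_mult_commute:
  assumes "A \<in> carrier_mat n m" "B \<in> carrier_mat m n"
  shows "mat_trace (A * B) = mat_trace (B * A)"
proof -
  have "mat_trace (A * B) = (\<Sum>a<n. \<Sum>b<m. A $$ (a, b) * B $$ (b, a))"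
    using assms by (auto simp: mat_trace_def scalar_prod_def atLeast0LessThan)
  also have "\<dots> = (\<Sum>b<m. \<Sum>a<n. B $$ (b, a) * A $$ (a, b))"
    by (subst sum.swap) (simp add: mult.commute)
  also have "\<dots> = mat_trace (B * A)"
    using assms by (auto simp: mat_trace_def scalar_prod_def atLeast0LessThan)
  finally show ?thesis .
qed

definition hs_norm_sq :: "complex mat \<Rightarrow> real" where
  "hs_norm_sq A = (\<Sum>a<dim_row A. \<Sum>b<dim_col A. (cmod (A $$ (a, b)))\<^sup>2)"

lemma hs_norm_sq_trace: "complex_of_real (hs_norm_sq A) = mat_trace (mat_adjoint A * A)"
proof -
  have "mat_trace (mat_adjoint A * A)
      = (\<Sum>b<dim_col A. \<Sum>a<dim_row A. cnj (A $$ (a, b)) * A $$ (a, b))"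
    by (simp add: mat_trace_def scalar_prod_def atLeast0LessThan)
  also have "\<dots> = (\<Sum>a<dim_row A. \<Sum>b<dim_col A. complex_of_real ((cmod (A $$ (a, b)))\<^sup>2))"
    by (subst sum.swap) (simp add: complex_norm_square mult.commute del: of_real_power)
  finally show ?thesis by (simp add: hs_norm_sq_def)
qed

text \<open>
  The squared norm is the trace of \<open>A\<^sup>*A\<close>. Replacing \<open>A\<close> by \<open>U\<^sup>*AU\<close> conjugates \<open>A\<^sup>*A\<close> by \<open>U\<close> as
  well, and cyclicity of the trace then removes \<open>U\<close>.
\<close>

lemma hs_norm_sq_unitary:
  assumes U: "unitary_mat d U" and A: "A \<in> carrier_mat d d"
  shows "hs_norm_sq (Ad U A) = hs_norm_sq A"
proof -
  have Uc [simp]: "U \<in> carrier_mat d d" and UU: "U * mat_adjoint U = 1\<^sub>m d"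
    using U by (auto simp: unitary_mat_def)
  have U': "mat_adjoint U \<in> carrier_mat d d" and A': "mat_adjoint A \<in> carrier_mat d d"
    using A by auto
  note assoc = assoc_mult_mat[of _ d d _ d _ d]
  have UUZ: "U * (mat_adjoint U * Z) = Z" if "Z \<in> carrier_mat d d" for Z
    using that UU U' by (simp flip: assoc)
  have "mat_adjoint (Ad U A) = mat_adjoint U * (mat_adjoint A * U)"
    using A A' U' by (simp add: Ad_def mat_adjoint_mult[OF mult_carrier_mat[OF U' A] Uc]
        mat_adjoint_mult[OF U' A])
  then have "mat_adjoint (Ad U A) * Ad U A = mat_adjoint U * (mat_adjoint A * A * U)"
    using A A' U' by (simp add: Ad_def assoc UUZ mult_carrier_mat[of _ d d _ d])
  then have "complex_of_real (hs_norm_sq (Ad U A)) = mat_trace (mat_adjoint U * (mat_adjoint A * A * U))"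
    by (simp add: hs_norm_sq_trace)
  also have "\<dots> = mat_trace (mat_adjoint A * A * U * mat_adjoint U)"
    using A A' U' by (intro mat_trace_mult_commute[of _ d d] mult_carrier_mat[of _ d d _ d]) auto
  also have "\<dots> = complex_of_real (hs_norm_sq A)"
    using A A' U' UU by (simp add: assoc hs_norm_sq_trace)
  finally show ?thesis by (simp only: of_real_eq_iff)
qed

text \<open>
  Because \<open>m\<close> is the weighted mean, the cross terms of the expanded squares add up to
  \<open>-2 \<parallel>m\<parallel>\<^sup>2\<close>. The identity turns a statement about norms (all \<open>y\<^sub>i\<close> have the norm of \<open>m\<close>) into
  one about distances to \<open>m\<close>.
\<close>

lemma weighted_variance:
  fixes y :: "'i \<Rightarrow> 'a::real_inner" and t :: "'i \<Rightarrow> real"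
  assumes t: "(\<Sum>i\<in>I. t i) = 1" and m: "m = (\<Sum>i\<in>I. t i *\<^sub>R y i)"
  shows "(\<Sum>i\<in>I. t i * (norm (y i - m))\<^sup>2) = (\<Sum>i\<in>I. t i * (norm (y i))\<^sup>2) - (norm m)\<^sup>2"
proof -
  have "(\<Sum>i\<in>I. t i * (norm (y i - m))\<^sup>2)
      = (\<Sum>i\<in>I. t i * (norm (y i))\<^sup>2 - 2 * inner (t i *\<^sub>R y i) m + t i * (norm m)\<^sup>2)"
    by (rule sum.cong) (auto simp: power2_norm_eq_inner inner_diff inner_commute algebra_simps)
  also have "\<dots> = (\<Sum>i\<in>I. t i * (norm (y i))\<^sup>2) - 2 * inner (\<Sum>i\<in>I. t i *\<^sub>R y i) m
      + (\<Sum>i\<in>I. t i) * (norm m)\<^sup>2"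
    by (simp add: sum.distrib sum_subtractf sum_distrib_left sum_distrib_right inner_sum_left)
  also have "\<dots> = (\<Sum>i\<in>I. t i * (norm (y i))\<^sup>2) - (norm m)\<^sup>2"
    by (simp add: t flip: m) (simp add: power2_norm_eq_inner)
  finally show ?thesis .
qed

text \<open>
  Strict convexity of the Hilbert-Schmidt norm: summed over all entries, \<open>weighted_variance\<close> says
  that the weighted mean of the squared distances to \<open>Y\<close> vanishes, so each distance vanishes.
\<close>

lemma hs_sphere_average:
  assumes fin: "finite I" and t: "\<And>i. i \<in> I \<Longrightarrow> 0 < t i" "(\<Sum>i\<in>I. t i) = 1"
    and Z: "\<And>i. i \<in> I \<Longrightarrow> Z i \<in> carrier_mat d d"
    and norm: "\<And>i. i \<in> I \<Longrightarrow> hs_norm_sq (Z i) = hs_norm_sq Y"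
    and Y: "Y = finsum_mat d (\<lambda>i. complex_of_real (t i) \<cdot>\<^sub>m Z i) I"
    and j: "j \<in> I"
  shows "Z j = Y"
proof -
  have Yc: "Y \<in> carrier_mat d d"
    unfolding Y by (rule finsum_mat_carrier) (use fin Z in auto)
  have hs: "hs_norm_sq A = (\<Sum>a<d. \<Sum>b<d. (cmod (A $$ (a, b)))\<^sup>2)"
    if "A \<in> carrier_mat d d" for A
    using that by (auto simp: hs_norm_sq_def)
  let ?D = "\<lambda>i. \<Sum>a<d. \<Sum>b<d. (cmod (Z i $$ (a, b) - Y $$ (a, b)))\<^sup>2"
  have mean: "Y $$ (a, b) = (\<Sum>i\<in>I. t i *\<^sub>R Z i $$ (a, b))" if "a < d" "b < d" for a b
  proof -
    have "Y $$ (a, b) = (\<Sum>i\<in>I. (complex_of_real (t i) \<cdot>\<^sub>m Z i) $$ (a, b))"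
      unfolding Y by (rule finsum_mat_index) (use fin Z that in auto)
    also have "\<dots> = (\<Sum>i\<in>I. t i *\<^sub>R Z i $$ (a, b))"
      by (rule sum.cong) (use Z that in \<open>auto simp: scaleR_conv_of_real dest!: Z\<close>)
    finally show ?thesis .
  qed
  have swap: "(\<Sum>i\<in>I. t i * (\<Sum>a<d. \<Sum>b<d. g i a b)) = (\<Sum>a<d. \<Sum>b<d. \<Sum>i\<in>I. t i * g i a b)"
    for g :: "_ \<Rightarrow> nat \<Rightarrow> nat \<Rightarrow> real"
  proof -
    have "(\<Sum>i\<in>I. t i * (\<Sum>a<d. \<Sum>b<d. g i a b)) = (\<Sum>a<d. \<Sum>i\<in>I. \<Sum>b<d. t i * g i a b)"
      unfolding sum_distrib_left by (rule sum.swap)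
    also have "\<dots> = (\<Sum>a<d. \<Sum>b<d. \<Sum>i\<in>I. t i * g i a b)"
      by (intro sum.cong refl) (rule sum.swap)
    finally show ?thesis .
  qed
  have "(\<Sum>i\<in>I. t i * ?D i)
      = (\<Sum>a<d. \<Sum>b<d. (\<Sum>i\<in>I. t i * (cmod (Z i $$ (a, b)))\<^sup>2) - (cmod (Y $$ (a, b)))\<^sup>2)"
    unfolding swap by (intro sum.cong refl weighted_variance t mean) auto
  also have "\<dots> = (\<Sum>i\<in>I. t i * (\<Sum>a<d. \<Sum>b<d. (cmod (Z i $$ (a, b)))\<^sup>2)) - hs_norm_sq Y"
    unfolding swap hs[OF Yc] by (simp add: sum_subtractf)
  also have "(\<Sum>i\<in>I. t i * (\<Sum>a<d. \<Sum>b<d. (cmod (Z i $$ (a, b)))\<^sup>2)) = (\<Sum>i\<in>I. t i) * hs_norm_sq Y"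
    unfolding sum_distrib_right by (rule sum.cong) (auto simp: Z norm simp flip: hs)
  finally have "(\<Sum>i\<in>I. t i * ?D i) = 0" by (simp add: t)
  moreover have "0 \<le> t i * ?D i" if "i \<in> I" for i
    using t(1)[OF that] by (intro mult_nonneg_nonneg sum_nonneg) auto
  ultimately have "t j * ?D j = 0" using fin j by (subst (asm) sum_nonneg_eq_0_iff) auto
  then have "?D j = 0" using t(1)[OF j] by simp
  then have "\<forall>a<d. \<forall>b<d. (cmod (Z j $$ (a, b) - Y $$ (a, b)))\<^sup>2 = 0"
    by (simp add: sum_nonneg_eq_0_iff sum_nonneg)
  then show ?thesis using Z[OF j] Yc by (intro eq_matI) auto
qed

section \<open>Extreme points\<close>

lemma UEB_carrier: "\<Psi> \<in> UEB d1 d2 \<Longrightarrow> X \<in> carrier_mat d1 d1 \<Longrightarrow> \<Psi> X \<in> carrier_mat d2 d2"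
  by (simp add: UEB_def entanglement_breaking_def completely_positive_def linear_mat_map_def)

lemma invertible_scalar_mat:
  assumes "c \<noteq> 0"
  shows "invertible_mat (c \<cdot>\<^sub>m 1\<^sub>m d :: complex mat)"
proof -
  have *: "(a \<cdot>\<^sub>m 1\<^sub>m d) * (b \<cdot>\<^sub>m 1\<^sub>m d) = (a * b) \<cdot>\<^sub>m (1\<^sub>m d :: complex mat)" for a b :: complex
    by (subst mult_smult_assoc_mat[of _ d d _ d]) auto
  show ?thesis
    unfolding invertible_mat_def inverts_mat_def
    using assms * by (intro conjI exI[of _ "inverse c \<cdot>\<^sub>m 1\<^sub>m d"]) (auto intro!: eq_matI)
qed

theorem proposition3p5:
  fixes d1 d2 :: nat
  shows "UEB_Cstar_ext d1 d2 \<subseteq> UEB_ext d1 d2"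
proof
  fix \<Phi> assume \<Phi>: "\<Phi> \<in> UEB_Cstar_ext d1 d2"
  then have \<Phi>_UEB: "\<Phi> \<in> UEB d1 d2" by (simp add: UEB_Cstar_ext_def)
  have Cstar_ext: "\<exists>U. \<forall>i<n. unitary_mat d2 (U i) \<and>
        (\<forall>X \<in> carrier_mat d1 d1. \<Psi> i X = Ad (U i) (\<Phi> X))"
    if "(\<forall>i<n. \<Psi> i \<in> UEB d1 d2 \<and> T i \<in> carrier_mat d2 d2 \<and> invertible_mat (T i)) \<and>
       finsum_mat d2 (\<lambda>i. mat_adjoint (T i) * T i) {..<n} = 1\<^sub>m d2 \<and>
       (\<forall>X \<in> carrier_mat d1 d1. \<Phi> X = finsum_mat d2 (\<lambda>i. Ad (T i) (\<Psi> i X)) {..<n})"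
    for n :: nat and T \<Psi>
    using \<Phi> unfolding UEB_Cstar_ext_def mem_Collect_eq
    by (elim conjE[of "\<Phi> \<in> UEB d1 d2"] allE[of _ n] allE[of _ T] allE[of _ \<Psi>] impE) (rule that)
  have eq: "\<Psi> j X = \<Phi> X"
    if \<Psi>: "\<forall>i<n. \<Psi> i \<in> UEB d1 d2 \<and> 0 < t i \<and> t i < 1" and t: "(\<Sum>i<n. t i) = 1"
      and avg: "\<forall>X \<in> carrier_mat d1 d1.
          \<Phi> X = finsum_mat d2 (\<lambda>i. complex_of_real (t i) \<cdot>\<^sub>m \<Psi> i X) {..<n}"
      and j: "j < n" and X: "X \<in> carrier_mat d1 d1"
    for n :: nat and t :: "nat \<Rightarrow> real" and \<Psi> j X
  proof -
    define T where "T i = complex_of_real (sqrt (t i)) \<cdot>\<^sub>m 1\<^sub>m d2" for i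
    have Ad_T: "Ad (T i) Y = complex_of_real (t i) \<cdot>\<^sub>m Y" if "i < n" "Y \<in> carrier_mat d2 d2" for i Y
      using Ad_scalar[OF that(2), of "sqrt (t i)"] \<Psi> that(1)
      by (simp add: T_def less_imp_le del: of_real_power)
    have T: "T i \<in> carrier_mat d2 d2 \<and> invertible_mat (T i)" if "i < n" for i
      using \<Psi> that invertible_scalar_mat[of "complex_of_real (sqrt (t i))"] by (auto simp: T_def)
    have TT: "mat_adjoint (T i) * T i = complex_of_real (t i) \<cdot>\<^sub>m 1\<^sub>m d2" if "i < n" for i
      using Ad_T[OF that, of "1\<^sub>m d2"] T[OF that]
      by (simp add: Ad_def right_mult_one_mat[of _ d2 d2])
    have "finsum_mat d2 (\<lambda>i. mat_adjoint (T i) * T i) {..<n}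
        = finsum_mat d2 (\<lambda>i. complex_of_real (t i) \<cdot>\<^sub>m 1\<^sub>m d2) {..<n}"
      by (rule finsum_mat_cong) (auto simp: TT)
    also have "\<dots> = 1\<^sub>m d2"
    proof (rule eq_matI)
      fix a b assume "a < dim_row (1\<^sub>m d2 :: complex mat)" "b < dim_col (1\<^sub>m d2 :: complex mat)"
      then show "finsum_mat d2 (\<lambda>i. complex_of_real (t i) \<cdot>\<^sub>m 1\<^sub>m d2) {..<n} $$ (a, b)
          = (1\<^sub>m d2 :: complex mat) $$ (a, b)"
        using t by (subst finsum_mat_index) (auto simp flip: of_real_sum)
    qed (use finsum_mat_carrier[of "{..<n}" "\<lambda>i. complex_of_real (t i) \<cdot>\<^sub>m 1\<^sub>m d2" d2] in auto)
    finally have unital: "finsum_mat d2 (\<lambda>i. mat_adjoint (T i) * T i) {..<n} = 1\<^sub>m d2" .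
    have "\<forall>X \<in> carrier_mat d1 d1. \<Phi> X = finsum_mat d2 (\<lambda>i. Ad (T i) (\<Psi> i X)) {..<n}"
    proof
      fix X :: "complex mat" assume X: "X \<in> carrier_mat d1 d1"
      show "\<Phi> X = finsum_mat d2 (\<lambda>i. Ad (T i) (\<Psi> i X)) {..<n}"
        unfolding avg[rule_format, OF X]
        by (rule finsum_mat_cong[symmetric]) (use \<Psi> X in \<open>auto simp: Ad_T UEB_carrier\<close>)
    qed
    moreover have "\<forall>i<n. \<Psi> i \<in> UEB d1 d2 \<and> T i \<in> carrier_mat d2 d2 \<and> invertible_mat (T i)"
      using \<Psi> T by simp
    ultimately have "\<exists>U. \<forall>i<n. unitary_mat d2 (U i) \<and>
        (\<forall>X \<in> carrier_mat d1 d1. \<Psi> i X = Ad (U i) (\<Phi> X))"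
      using unital by (intro Cstar_ext conjI)
    then obtain U where U: "\<forall>i<n. unitary_mat d2 (U i) \<and>
        (\<forall>X \<in> carrier_mat d1 d1. \<Psi> i X = Ad (U i) (\<Phi> X))" by (rule exE)
    show ?thesis
    proof (rule hs_sphere_average[where I = "{..<n}" and t = t and Z = "\<lambda>i. \<Psi> i X" and d = d2])
      show "hs_norm_sq (\<Psi> i X) = hs_norm_sq (\<Phi> X)" if "i \<in> {..<n}" for i
        using U that X hs_norm_sq_unitary[OF _ UEB_carrier[OF \<Phi>_UEB X]] by auto
    qed (use \<Psi> t avg j X in \<open>auto simp: UEB_carrier\<close>)
  qed
  show "\<Phi> \<in> UEB_ext d1 d2"
    unfolding UEB_ext_def mem_Collect_eq
    by (intro conjI allI impI ballI \<Phi>_UEB; elim conjE) (rule eq)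
qed

end
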